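(* Every graph $G$ is $\lfloor\frac{7}{10}\operatorname{mad}(G)+1\rfloor$-choosable with clustering $9$.
   Context: Graphs are finite and simple. $\operatorname{mad}(G)$ is the maximum, over all subgraphs $H$ of $G$, of the average degree of $H$. In a coloured graph the monochromatic subgraph is the spanning subgraph of edges whose endpoints have the same colour; its connected components are monochromatic components. A colouring has clustering $c$ if every monochromatic component has at most $c$ vertices. A $k$-list-assignment $L$ assigns to each vertex $v$ a set $L(v)$ of at least $k$ colours; an $L$-colouring colours each $v$ with a colour from $L(v)$. $G$ is $k$-choosable with clustering $c$ if for every $k$-list-assignment $L$, $G$ has an $L$-colouring with clustering $c$. *)

theory Defs
  imports Complex_Main "Graph_Theory.Graph_Theory"
begin

text \<open>
  A finite simple graph is a \<open>pair_graph\<close>: a finite symmetric loop-free digraph without parallel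
  arcs, where each edge \<open>uv\<close> is present as the two arcs \<open>(u, v)\<close> and \<open>(v, u)\<close>. Hence the degree of
  a vertex is its \<open>out_degree\<close>, and the edges number half the arcs.
\<close>

text \<open>The average degree of the null graph is \<open>0\<close>, because \<open>0 / 0 = 0\<close>.\<close>

definition average_degree :: "'a pair_pre_digraph \<Rightarrow> real" where
  "average_degree G = (\<Sum>v\<in>pverts G. real (out_degree (with_proj G) v)) / real (card (pverts G))"

text \<open>
  Subgraphs of \<open>G\<close> are required to be graphs themselves, since \<open>subgraph\<close> alone also admits
  non-symmetric digraphs. The null subgraph is admitted; as its average degree is \<open>0\<close>, it affects
  the maximum only when \<open>G\<close> is itself the null graph, which thereby gets the value \<open>0\<close>.
\<close>

definition mad :: "'a pair_pre_digraph \<Rightarrow> real" where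
  "mad G = Max {average_degree H | H. pair_graph H \<and> subgraph (with_proj H) (with_proj G)}"

definition monochromatic_subgraph ::
    "'a pair_pre_digraph \<Rightarrow> ('a \<Rightarrow> 'c) \<Rightarrow> 'a pair_pre_digraph" where
  "monochromatic_subgraph G f =
     \<lparr>pverts = pverts G, parcs = {e \<in> parcs G. f (fst e) = f (snd e)}\<rparr>"

definition monochromatic_component ::
    "'a pair_pre_digraph \<Rightarrow> ('a \<Rightarrow> 'c) \<Rightarrow> ('a, 'a \<times> 'a) pre_digraph \<Rightarrow> bool" where
  "monochromatic_component G f C \<longleftrightarrow>
     pre_digraph.max_subgraph (with_proj (monochromatic_subgraph G f)) Digraph_Component.connected C"

definition has_clustering :: "'a pair_pre_digraph \<Rightarrow> ('a \<Rightarrow> 'c) \<Rightarrow> nat \<Rightarrow> bool" where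
  "has_clustering G f c \<longleftrightarrow> (\<forall>C. monochromatic_component G f C \<longrightarrow> card (verts C) \<le> c)"

text \<open>Lists may be infinite; \<open>card\<close> is \<open>0\<close> on infinite sets, so these are treated separately.\<close>

definition list_assignment :: "nat \<Rightarrow> 'a pair_pre_digraph \<Rightarrow> ('a \<Rightarrow> 'c set) \<Rightarrow> bool" where
  "list_assignment k G L \<longleftrightarrow> (\<forall>v\<in>pverts G. infinite (L v) \<or> k \<le> card (L v))"

definition list_colouring :: "'a pair_pre_digraph \<Rightarrow> ('a \<Rightarrow> 'c set) \<Rightarrow> ('a \<Rightarrow> 'c) \<Rightarrow> bool" where
  "list_colouring G L f \<longleftrightarrow> (\<forall>v\<in>pverts G. f v \<in> L v)"

text \<open>
  The first argument only fixes the type \<open>'c\<close> from which the colours are drawn. A statement with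
  \<open>'c\<close> a free type variable covers list assignments with colours of any type.
\<close>

definition choosable_with_clustering ::
    "'c itself \<Rightarrow> nat \<Rightarrow> nat \<Rightarrow> 'a pair_pre_digraph \<Rightarrow> bool" where
  "choosable_with_clustering (_ :: 'c itself) k c G \<longleftrightarrow>
     (\<forall>L :: 'a \<Rightarrow> 'c set. list_assignment k G L \<longrightarrow>
        (\<exists>f. list_colouring G L f \<and> has_clustering G f c))"

end

theory Submission
  imports Defs "HOL-Library.FuncSet"
begin

text \<open>
  Write \<open>u ~ v\<close> for adjacency. The density of \<open>G\<close> lets us choose positive vertex weights \<open>x\<close> such
  that, for every \<open>v\<close>, the sum of \<open>x v / (x u + x v)\<close> over all \<open>u ~ v\<close> is less than \<open>5/7 * k\<close>. These
  are weights of a Bradley--Terry model: each edge distributes one unit among its two ends, and \<open>x\<close>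
  minimises a convex energy. In an \<open>L\<close>-colouring of minimum total monochromatic weight, where \<open>uv\<close>
  has weight \<open>1 / (x u + x v)\<close>, recolouring \<open>v\<close> does not help, so averaging over the \<open>k\<close> colours of
  \<open>v\<close> shows that the monochromatic edges at \<open>v\<close> give \<open>v\<close> less than \<open>5/7\<close>. Summing over a
  monochromatic component \<open>C\<close>, it has fewer than \<open>5/7 * |C|\<close> edges; being connected it has at
  least \<open>|C| - 1\<close>. Hence \<open>|C| \<le> 3\<close>.
\<close>

section \<open>Balanced vertex weights\<close>

text \<open>Isolates the terms that change when only \<open>v\<close> is reweighted or recoloured.
  Each edge at \<open>v\<close> occurs as two distinct arcs, whence the factor 2.\<close>

lemma sum_edges_at:
  fixes g :: "'a \<Rightarrow> 'a \<Rightarrow> real"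
  assumes "finite E" "sym E" "irrefl E" and g: "\<And>u w. g u w = g w u"
  shows "(\<Sum>(u, w)\<in>E. g u w) =
    (\<Sum>(u, w)\<in>{(u, w) \<in> E. u \<noteq> v \<and> w \<noteq> v}. g u w) + 2 * (\<Sum>u\<in>E `` {v}. g u v)"
proof -
  let ?O = "{(u, w) \<in> E. u \<noteq> v \<and> w \<noteq> v}" and ?N = "E `` {v}"
  have fN: "finite ?N"
    using \<open>finite E\<close> by (auto intro: finite_Image)
  have E: "E = ?O \<union> (Pair v ` ?N \<union> (\<lambda>u. (u, v)) ` ?N)"
    using \<open>sym E\<close> by (auto dest: symD)
  have fO: "finite ?O"
    using \<open>finite E\<close> by (rule rev_finite_subset) auto
  have "(\<Sum>(u, w)\<in>E. g u w) = (\<Sum>(u, w)\<in>?O. g u w)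
      + (\<Sum>(u, w)\<in>Pair v ` ?N \<union> (\<lambda>u. (u, v)) ` ?N. g u w)"
    by (subst E, rule sum.union_disjoint) (use fO fN in auto)
  also have "(\<Sum>(u, w)\<in>Pair v ` ?N \<union> (\<lambda>u. (u, v)) ` ?N. g u w)
      = (\<Sum>(u, w)\<in>Pair v ` ?N. g u w) + (\<Sum>(u, w)\<in>(\<lambda>u. (u, v)) ` ?N. g u w)"
    by (rule sum.union_disjoint) (use fN \<open>irrefl E\<close> in \<open>auto simp: irrefl_def\<close>)
  also have "(\<Sum>(u, w)\<in>Pair v ` ?N. g u w) = (\<Sum>u\<in>?N. g u v)"
    by (subst sum.reindex) (auto simp: inj_on_def intro!: sum.cong g)
  also have "(\<Sum>(u, w)\<in>(\<lambda>u. (u, v)) ` ?N. g u w) = (\<Sum>u\<in>?N. g u v)"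
    by (subst sum.reindex) (auto simp: inj_on_def)
  finally show ?thesis
    by simp
qed

text \<open>Layer-cake argument: \<open>min (n u) (n v)\<close> counts the thresholds
  \<open>t\<close> for which both ends lie in the superlevel set \<open>S t\<close>, and the density
  bound applies to each \<open>S t\<close>.\<close>

lemma sum_min_le_density:
  fixes n :: "'a \<Rightarrow> nat"
  assumes "finite V" "E \<subseteq> V \<times> V"
    and density: "\<And>S. S \<subseteq> V \<Longrightarrow> real (card (E \<inter> S \<times> S)) \<le> m * real (card S)"
  shows "(\<Sum>(u, v)\<in>E. real (min (n u) (n v))) \<le> m * (\<Sum>v\<in>V. real (n v))"
proof -
  define N where "N = Max (n ` V)"
  have N: "n v \<le> N" if "v \<in> V" for v
    using that \<open>finite V\<close> by (simp add: N_def)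
  define S where "S t = {v \<in> V. t < n v}" for t
  have finE: "finite E"
    using assms(1,2) finite_subset by blast
  have level: "real a = (\<Sum>t<N. of_bool (t < a))" if "a \<le> N" for a
  proof -
    have "{..<N} \<inter> {t. t < a} = {..<a}"
      using that by auto
    then show ?thesis
      by (simp add: of_bool_def sum.If_cases)
  qed
  have "(\<Sum>(u, v)\<in>E. real (min (n u) (n v)))
      = (\<Sum>(u, v)\<in>E. \<Sum>t<N. of_bool (t < min (n u) (n v)))"
    using assms(2) N by (intro sum.cong refl) (auto simp only: split: prod.splits intro!: level min.coboundedI1)
  also have "\<dots> = (\<Sum>t<N. \<Sum>e\<in>E. of_bool (e \<in> S t \<times> S t))"
    using assms(2)
    by (subst sum.swap) (auto simp: case_prod_beta S_def intro!: sum.cong)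
  also have "\<dots> = (\<Sum>t<N. real (card (E \<inter> S t \<times> S t)))"
    using finE by (simp add: of_bool_def sum.If_cases)
  also have "\<dots> \<le> (\<Sum>t<N. m * real (card (S t)))"
    by (intro sum_mono density) (auto simp: S_def)
  also have "\<dots> = m * (\<Sum>t<N. \<Sum>v\<in>V. of_bool (t < n v))"
    using \<open>finite V\<close> by (simp add: S_def of_bool_def sum.If_cases sum_distrib_left Int_def)
  also have "\<dots> = m * (\<Sum>v\<in>V. real (n v))"
    by (subst sum.swap) (simp add: level N)
  finally show ?thesis .
qed

text \<open>
  The weights are \<open>x v = exp (- h * n v)\<close> for a small step \<open>h\<close>, with \<open>n\<close> minimising the energy \<open>J\<close> over
  functions into \<open>{..N}\<close>, so that no compactness or differentiability is needed. The density
  hypothesis makes \<open>J\<close> coercive, so \<open>n v < N\<close>, and comparing \<open>n\<close> with \<open>n(v := Suc (n v))\<close> bounds the sum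
  at \<open>v\<close>.
\<close>

lemma exists_balanced_weights:
  assumes "finite V" "E \<subseteq> V \<times> V" "sym E" "irrefl E"
    and density: "\<And>S. S \<subseteq> V \<Longrightarrow> real (card (E \<inter> S \<times> S)) \<le> m * real (card S)"
    and "0 \<le> m" "m < M"
  obtains x :: "'a \<Rightarrow> real" where "\<And>v. 0 < x v"
    and "\<And>v. v \<in> V \<Longrightarrow> 2 * (\<Sum>u\<in>E `` {v}. x v / (x u + x v)) < M"
proof -
  \<comment> \<open>\<open>R > m\<close> makes the energy coercive. \<open>R < M\<close> absorbs the
    factor \<open>1 + h\<close> lost to the step size, as \<open>h\<close> is chosen with
    \<open>R * (1 + h) = (M + R) / 2\<close>.\<close>
  obtain R where R: "m < R" "R < M"
    using \<open>m < M\<close> dense by blast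
  then have "0 < R"
    using \<open>0 \<le> m\<close> by simp
  define h where "h = (M - R) / (2 * R)"
  have "0 < h"
    using R \<open>0 < R\<close> by (simp add: h_def)
  have Rh: "R * (1 + h) < M"
    using R \<open>0 < R\<close> by (simp add: h_def field_simps)
  have finE: "finite E"
    using assms(1,2) finite_subset by blast
  define y where "y i = exp (- h * real i)" for i :: nat
  have y: "0 < y i" for i
    by (simp add: y_def)
  \<comment> \<open>With \<open>x v = y (n v)\<close> this is the sum of
    \<open>ln (x u + x w)\<close> over all arcs minus \<open>R\<close> times the sum of
    \<open>ln (x v)\<close>. Its derivative in \<open>ln (x v)\<close> is the quantity to be bounded
    at \<open>v\<close>, minus \<open>R\<close>.\<close>
  define J where "J n = (\<Sum>(u, w)\<in>E. ln (y (n u) + y (n w))) + R * h * (\<Sum>v\<in>V. real (n v))"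
    for n :: "'a \<Rightarrow> nat"
  \<comment> \<open>\<open>y i + y j\<close> is at least its larger term, the one with the smaller
    index; the sum of these minima is bounded by \<open>sum_min_le_density\<close>.\<close>
  have lower: "h * (R - m) * (\<Sum>v\<in>V. real (n v)) \<le> J n" for n
  proof -
    have "- h * real (min i j) \<le> ln (y i + y j)" for i j
    proof -
      have "exp (- h * real (min i j)) \<le> y i + y j"
        using y[of i] y[of j] by (cases "i \<le> j") (auto simp: y_def min_def)
      then show ?thesis
        using y[of i] y[of j] by (simp add: ln_ge_iff add_pos_pos)
    qed
    then have "(\<Sum>(u, w)\<in>E. - h * real (min (n u) (n w))) \<le> (\<Sum>(u, w)\<in>E. ln (y (n u) + y (n w)))"
      by (intro sum_mono) auto
    moreover have "(\<Sum>(u, w)\<in>E. - h * real (min (n u) (n w)))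
        = - h * (\<Sum>(u, w)\<in>E. real (min (n u) (n w)))"
      by (simp add: sum_distrib_left case_prod_beta)
    moreover have "h * (\<Sum>(u, w)\<in>E. real (min (n u) (n w))) \<le> h * (m * (\<Sum>v\<in>V. real (n v)))"
      using \<open>0 < h\<close> by (intro mult_left_mono sum_min_le_density assms) auto
    ultimately show ?thesis
      by (simp add: J_def algebra_simps)
  qed
  \<comment> \<open>By \<open>lower\<close>, a value of at least \<open>N\<close> anywhere on
    \<open>V\<close> costs more than the zero function, whose energy is
    \<open>card E * ln 2\<close>.\<close>
  obtain N :: nat where N: "real (card E) * ln 2 / (h * (R - m)) < real N"
    using reals_Archimedean2 by blast
  define B where "B = V \<rightarrow>\<^sub>E {..N}"
  have "finite B" "(\<lambda>v\<in>V. 0) \<in> B"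
    using \<open>finite V\<close> by (auto simp: B_def intro: finite_PiE)
  then obtain n where n: "n \<in> B" and J_min: "\<And>n'. n' \<in> B \<Longrightarrow> J n \<le> J n'"
    using ex_is_arg_min_if_finite[of B J] unfolding is_arg_min_linorder by blast
  have J0: "J (\<lambda>v\<in>V. 0) = real (card E) * ln 2"
  proof -
    have "(\<Sum>(u, w)\<in>E. ln (y ((\<lambda>v\<in>V. 0) u) + y ((\<lambda>v\<in>V. 0) w))) = (\<Sum>e\<in>E. ln 2)"
      using assms(2) by (intro sum.cong) (auto simp: y_def)
    then show ?thesis
      by (simp add: J_def)
  qed
  have below: "n v < N" if "v \<in> V" for v
  proof (rule ccontr)
    assume "\<not> n v < N"
    then have "real (card E) * ln 2 / (h * (R - m)) < real (n v)"
      using N by linarith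
    then have "real (card E) * ln 2 < h * (R - m) * real (n v)"
      using R \<open>0 < h\<close> by (simp add: pos_divide_less_eq mult.commute)
    also have "\<dots> \<le> h * (R - m) * (\<Sum>v\<in>V. real (n v))"
      using R \<open>0 < h\<close> \<open>finite V\<close> that by (intro mult_left_mono member_le_sum) auto
    also have "\<dots> \<le> J n"
      by (rule lower)
    also have "\<dots> \<le> real (card E) * ln 2"
      using J_min[OF \<open>(\<lambda>v\<in>V. 0) \<in> B\<close>] by (simp add: J0)
    finally show False
      by simp
  qed
  have "2 * (\<Sum>u\<in>E `` {v}. y (n v) / (y (n u) + y (n v))) < M" if v: "v \<in> V" for v
  proof -
    let ?n = "n(v := Suc (n v))" and ?q = "\<Sum>u\<in>E `` {v}. y (n v) / (y (n u) + y (n v))"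
    have "?n \<in> B"
      using n below[OF v] v by (auto simp: B_def PiE_def extensional_def)
    have other: "u \<noteq> v" if "u \<in> E `` {v}" for u
      using that \<open>irrefl E\<close> by (auto simp: irrefl_def)
    have split: "J k = (\<Sum>(u, w)\<in>{(u, w) \<in> E. u \<noteq> v \<and> w \<noteq> v}. ln (y (k u) + y (k w)))
        + 2 * (\<Sum>u\<in>E `` {v}. ln (y (k u) + y (k v)))
        + R * h * ((\<Sum>v\<in>V - {v}. real (k v)) + real (k v))" for k
      unfolding J_def
      by (subst sum_edges_at[OF finE \<open>sym E\<close> \<open>irrefl E\<close>, where v = v], simp only: add.commute)
        (simp add: sum.remove[OF \<open>finite V\<close> v])
    have "J ?n - J n = 2 * ((\<Sum>u\<in>E `` {v}. ln (y (n u) + y (Suc (n v))))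
        - (\<Sum>u\<in>E `` {v}. ln (y (n u) + y (n v)))) + R * h"
    proof -
      have "(\<Sum>(u, w)\<in>{(u, w) \<in> E. u \<noteq> v \<and> w \<noteq> v}. ln (y (?n u) + y (?n w)))
          = (\<Sum>(u, w)\<in>{(u, w) \<in> E. u \<noteq> v \<and> w \<noteq> v}. ln (y (n u) + y (n w)))"
        by (intro sum.cong) auto
      moreover have "(\<Sum>u\<in>E `` {v}. ln (y (?n u) + y (?n v)))
          = (\<Sum>u\<in>E `` {v}. ln (y (n u) + y (Suc (n v))))"
        using other by (intro sum.cong) auto
      moreover have "(\<Sum>u\<in>V - {v}. real (?n u)) = (\<Sum>u\<in>V - {v}. real (n u))"
        by (intro sum.cong) auto
      ultimately show ?thesis
        unfolding split by (simp add: algebra_simps)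
    qed
    then have J: "2 * (\<Sum>u\<in>E `` {v}. ln (y (n u) + y (n v)) - ln (y (n u) + y (Suc (n v)))) \<le> R * h"
      using J_min[OF \<open>?n \<in> B\<close>] by (simp add: sum_subtractf)
    \<comment> \<open>Raising \<open>n v\<close> by one multiplies \<open>x v\<close> by
      \<open>exp (- h)\<close>. The drop of the logarithm is bounded below by
      \<open>ln t \<le> t - 1\<close> at \<open>t = ?b / ?a\<close>.\<close>
    have step: "(1 - exp (- h)) * (y (n v) / (y (n u) + y (n v)))
        \<le> ln (y (n u) + y (n v)) - ln (y (n u) + y (Suc (n v)))" for u
    proof -
      let ?a = "y (n u) + y (n v)" and ?b = "y (n u) + y (Suc (n v))"
      have pos: "0 < ?a" "0 < ?b"
        using y by (auto intro: add_pos_pos)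
      have "y (Suc (n v)) = exp (- h) * y (n v)"
        by (simp add: y_def algebra_simps flip: exp_add)
      then have "(1 - exp (- h)) * (y (n v) / ?a) = 1 - ?b / ?a"
        using pos by (simp add: field_simps)
      also have "\<dots> \<le> - ln (?b / ?a)"
        using ln_le_minus_one[of "?b / ?a"] pos by simp
      also have "\<dots> = ln ?a - ln ?b"
        using pos by (simp add: ln_div)
      finally show ?thesis .
    qed
    have "2 * ((1 - exp (- h)) * ?q) \<le> R * h"
    proof -
      have "(1 - exp (- h)) * ?q
          \<le> (\<Sum>u\<in>E `` {v}. ln (y (n u) + y (n v)) - ln (y (n u) + y (Suc (n v))))"
        unfolding sum_distrib_left by (intro sum_mono step)
      with J show ?thesis
        by linarith
    qed
    \<comment> \<open>With this bound \<open>h\<close> cancels against \<open>R * h\<close>, and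
      only the factor \<open>1 + h\<close> remains.\<close>
    moreover have "h / (1 + h) \<le> 1 - exp (- h)"
    proof -
      have "exp (- h) \<le> 1 / (1 + h)"
        using exp_ge_add_one_self[of h] \<open>0 < h\<close> by (simp add: exp_minus field_simps)
      also have "\<dots> = 1 - h / (1 + h)"
        using \<open>0 < h\<close> by (simp add: field_simps)
      finally show ?thesis
        by simp
    qed
    moreover have "0 \<le> ?q"
      using y by (intro sum_nonneg divide_nonneg_nonneg add_nonneg_nonneg) (auto intro: less_imp_le)
    ultimately have "2 * (h / (1 + h) * ?q) \<le> R * h"
      using mult_right_mono[of "h / (1 + h)" "1 - exp (- h)" ?q] by linarith
    then have "h * (2 * ?q) \<le> h * (R * (1 + h))"
      using \<open>0 < h\<close> by (simp add: field_simps)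
    then have "2 * ?q \<le> R * (1 + h)"
      using \<open>0 < h\<close> by (simp only: mult_le_cancel_left_pos)
    with Rh show ?thesis
      by simp
  qed
  then show ?thesis
    using that[of "\<lambda>v. y (n v)"] y by blast
qed

section \<open>Colourings of minimum monochromatic weight\<close>

text \<open>Weighted form of Lovasz's defective colouring argument: for constant weight 1, at most a
  fraction \<open>1 / k\<close> of the neighbours of \<open>v\<close> share its colour.\<close>

lemma exists_weighted_defective_colouring:
  fixes w :: "'a \<Rightarrow> 'a \<Rightarrow> real" and L :: "'a \<Rightarrow> 'c set"
  assumes "finite V" "E \<subseteq> V \<times> V" "sym E" "irrefl E"
    and w: "\<And>u v. w u v = w v u" "\<And>u v. 0 \<le> w u v"
    and L: "\<And>v. v \<in> V \<Longrightarrow> infinite (L v) \<or> k \<le> card (L v)" and "0 < k"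
  obtains f where "\<And>v. v \<in> V \<Longrightarrow> f v \<in> L v"
    and "\<And>v. v \<in> V \<Longrightarrow>
      real k * (\<Sum>u\<in>{u \<in> E `` {v}. f u = f v}. w u v) \<le> (\<Sum>u\<in>E `` {v}. w u v)"
proof -
  \<comment> \<open>Cutting the lists to exactly \<open>k\<close> colours leaves finitely many
    colourings to minimise over, and \<open>k\<close> colours to average over.\<close>
  have "\<exists>T\<subseteq>L v. finite T \<and> card T = k" if "v \<in> V" for v
    using L[OF that] by (metis infinite_arbitrarily_large obtain_subset_with_card_n)
  then obtain T where T: "\<And>v. v \<in> V \<Longrightarrow> T v \<subseteq> L v \<and> finite (T v) \<and> card (T v) = k"
    by metis
  have finE: "finite E"
    using assms(1,2) finite_subset by blast
  define mono where "mono f = (\<Sum>(u, v)\<in>E. if f u = f v then w u v else 0)" for f :: "'a \<Rightarrow> 'c"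
  have "finite (Pi\<^sub>E V T)" "Pi\<^sub>E V T \<noteq> {}"
    using \<open>finite V\<close> T \<open>0 < k\<close> by (fastforce simp: PiE_eq_empty_iff intro: finite_PiE)+
  then obtain f where f: "f \<in> Pi\<^sub>E V T" and f_min: "\<And>f'. f' \<in> Pi\<^sub>E V T \<Longrightarrow> mono f \<le> mono f'"
    using ex_is_arg_min_if_finite[of "Pi\<^sub>E V T" mono] unfolding is_arg_min_linorder by blast
  have "real k * (\<Sum>u\<in>{u \<in> E `` {v}. f u = f v}. w u v) \<le> (\<Sum>u\<in>E `` {v}. w u v)"
    if v: "v \<in> V" for v
  proof -
    let ?N = "E `` {v}"
    let ?W = "\<lambda>c. \<Sum>u\<in>{u \<in> ?N. f u = c}. w u v"
    have fN: "finite ?N"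
      using finE by (auto intro: finite_Image)
    have fW: "finite {u \<in> ?N. f u = c}" for c
      by (rule finite_subset[OF _ fN]) auto
    have other: "u \<noteq> v" if "u \<in> ?N" for u
      using that \<open>irrefl E\<close> by (auto simp: irrefl_def)
    \<comment> \<open>Only the last term depends on \<open>c\<close>, so minimality of
      \<open>f\<close> directly compares the weights \<open>?W\<close> of the colours at
      \<open>v\<close>.\<close>
    have recolour: "mono (f(v := c)) =
        (\<Sum>(u, z)\<in>{(u, z) \<in> E. u \<noteq> v \<and> z \<noteq> v}. if f u = f z then w u z else 0) + 2 * ?W c" for c
    proof -
      have "mono (f(v := c)) =
          (\<Sum>(u, z)\<in>{(u, z) \<in> E. u \<noteq> v \<and> z \<noteq> v}.
            if (f(v := c)) u = (f(v := c)) z then w u z else 0)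
          + 2 * (\<Sum>u\<in>?N. if (f(v := c)) u = (f(v := c)) v then w u v else 0)"
        unfolding mono_def
        by (rule sum_edges_at[OF finE \<open>sym E\<close> \<open>irrefl E\<close>]) (auto simp: w(1))
      also have "(\<Sum>u\<in>?N. if (f(v := c)) u = (f(v := c)) v then w u v else 0)
          = (\<Sum>u\<in>?N. if f u = c then w u v else 0)"
        using other by (intro sum.cong) auto
      also have "\<dots> = ?W c"
        by (rule sum.inter_filter[OF fN, symmetric])
      also have "(\<Sum>(u, z)\<in>{(u, z) \<in> E. u \<noteq> v \<and> z \<noteq> v}.
            if (f(v := c)) u = (f(v := c)) z then w u z else 0)
          = (\<Sum>(u, z)\<in>{(u, z) \<in> E. u \<noteq> v \<and> z \<noteq> v}. if f u = f z then w u z else 0)"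
        by (intro sum.cong) auto
      finally show ?thesis .
    qed
    have "?W (f v) \<le> ?W c" if "c \<in> T v" for c
    proof -
      have "f(v := c) \<in> Pi\<^sub>E V T"
        using f that v by (auto simp: PiE_def extensional_def)
      from f_min[OF this] show ?thesis
        using recolour[of c] recolour[of "f v"] by simp
    qed
    then have "real k * ?W (f v) \<le> (\<Sum>c\<in>T v. ?W c)"
      using sum_bounded_below[of "T v" "?W (f v)" ?W] T[OF v] by simp
    also have "\<dots> = (\<Sum>u\<in>(\<Union>c\<in>T v. {u \<in> ?N. f u = c}). w u v)"
      using T[OF v] fW by (intro sum.UNION_disjoint[symmetric]) auto
    also have "\<dots> \<le> (\<Sum>u\<in>?N. w u v)"
      using fN w(2) by (intro sum_mono2) auto
    finally show ?thesis .
  qed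
  moreover have "f v \<in> L v" if "v \<in> V" for v
    using PiE_mem[OF f that] T[OF that] by blast
  ultimately show ?thesis
    using that by blast
qed

section \<open>Counting edges inside a component\<close>

text \<open>The tree bound, with each edge counted as two arcs. A largest \<open>S\<close>
  satisfying it is all of \<open>C\<close>, since otherwise an arc leaving \<open>S\<close> would
  let it grow.\<close>

lemma connected_card_le:
  assumes "finite C" "C \<noteq> {}" "sym r" "irrefl r"
    and conn: "\<And>u v. u \<in> C \<Longrightarrow> v \<in> C \<Longrightarrow> (u, v) \<in> (r \<inter> C \<times> C)\<^sup>*"
  shows "2 * card C \<le> card (r \<inter> C \<times> C) + 2"
proof -
  define P where "P S \<longleftrightarrow> S \<noteq> {} \<and> S \<subseteq> C \<and> 2 * card S \<le> card (r \<inter> S \<times> S) + 2" for S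
  obtain a where "a \<in> C"
    using \<open>C \<noteq> {}\<close> by blast
  then have "P {a}"
    by (simp add: P_def)
  moreover have "card S < Suc (card C)" if "P S" for S
    using that \<open>finite C\<close> by (auto simp: P_def card_mono less_Suc_eq_le)
  ultimately obtain S where S: "P S" and S_max: "\<And>S'. P S' \<Longrightarrow> card S' \<le> card S"
    using ex_has_greatest_nat[of P "{a}" card "Suc (card C)"] by (metis less_imp_le)
  have "finite S"
    using S \<open>finite C\<close> by (auto simp: P_def intro: finite_subset)
  have "S = C"
  proof (rule ccontr)
    assume "S \<noteq> C"
    then obtain s t where st: "s \<in> S" "t \<in> C" "t \<notin> S" "S \<subseteq> C"
      using S by (auto simp: P_def)
    have "\<exists>u\<in>S. \<exists>v\<in>C - S. (u, v) \<in> r"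
    proof (rule ccontr)
      assume closed: "\<not> ?thesis"
      have "(s, t) \<in> (r \<inter> C \<times> C)\<^sup>*"
        using conn st by blast
      then have "t \<in> S"
        by induction (use st closed in auto)
      then show False
        using st by blast
    qed
    then obtain u v where uv: "u \<in> S" "v \<in> C" "v \<notin> S" "(u, v) \<in> r"
      by blast
    \<comment> \<open>The new vertex \<open>v\<close> raises \<open>2 * card S\<close> by 2, which
      the new arcs \<open>(u, v)\<close> and \<open>(v, u)\<close> make up for.\<close>
    have "card (r \<inter> S \<times> S) + 2 = card (insert (u, v) (insert (v, u) (r \<inter> S \<times> S)))"
      using uv \<open>finite S\<close> by (subst card_insert_disjoint; auto)+
    also have "\<dots> \<le> card (r \<inter> insert v S \<times> insert v S)"
      using uv \<open>finite S\<close> \<open>sym r\<close> by (intro card_mono) (auto dest: symD)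
    finally have "P (insert v S)"
      using S uv \<open>finite S\<close> by (auto simp: P_def)
    then show False
      using S_max[of "insert v S"] uv \<open>finite S\<close> by simp
  qed
  with S show ?thesis
    by (simp add: P_def)
qed

text \<open>Reversing the arcs turns the share of one end of an edge into that of the other, and the
  two shares add up to 1.\<close>

lemma sum_balanced_ratio:
  fixes x :: "'a \<Rightarrow> real"
  assumes "sym r" "finite r" "\<And>v. 0 < x v"
  shows "2 * (\<Sum>(v, u)\<in>r. x v / (x u + x v)) = real (card r)"
proof -
  have "(\<Sum>(v, u)\<in>r. x v / (x u + x v)) = (\<Sum>(v, u)\<in>r. x u / (x u + x v))"
    by (rule sum.reindex_bij_witness[of _ prod.swap prod.swap])
      (use \<open>sym r\<close> in \<open>auto simp: add.commute dest: symD\<close>)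
  then have "2 * (\<Sum>(v, u)\<in>r. x v / (x u + x v))
      = (\<Sum>(v, u)\<in>r. x v / (x u + x v)) + (\<Sum>(v, u)\<in>r. x u / (x u + x v))"
    by simp
  also have "\<dots> = (\<Sum>e\<in>r. 1)"
    unfolding sum.distrib[symmetric]
  proof (intro sum.cong refl, clarify)
    fix u v
    show "x u / (x v + x u) + x v / (x v + x u) = 1"
      using assms(3)[of u] assms(3)[of v] by (simp add: add_pos_pos less_imp_neq[symmetric] add.commute
          flip: add_divide_distrib)
  qed
  finally show ?thesis
    by simp
qed

section \<open>Maximum average degree and monochromatic components\<close>

text \<open>Lets the \<open>Max\<close> in \<open>mad\<close> bound its members: a subgraph is given
  by a set of vertices and a set of arcs of \<open>G\<close>.\<close>

lemma finite_average_degrees: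
  assumes "pair_graph G"
  shows "finite {average_degree H | H. pair_graph H \<and> subgraph (with_proj H) (with_proj G)}"
proof -
  interpret pair_graph G by fact
  let ?A = "(\<lambda>(S, A). average_degree \<lparr>pverts = S, parcs = A\<rparr>) ` (Pow (pverts G) \<times> Pow (parcs G))"
  have "{average_degree H | H. pair_graph H \<and> subgraph (with_proj H) (with_proj G)} \<subseteq> ?A"
  proof clarify
    fix H :: "'a pair_pre_digraph"
    assume "subgraph (with_proj H) (with_proj G)"
    then show "average_degree H \<in> ?A"
      by (cases H) (auto simp: subgraph_def intro!: image_eqI[of _ _ "(pverts H, parcs H)"])
  qed
  then show ?thesis
    by (rule finite_subset) (simp add: pair_finite_verts pair_finite_arcs)
qed

text \<open>The out-degrees in the subgraph induced by \<open>S\<close> add up to its number of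
  arcs; as arcs are counted, no factor 2 appears.\<close>

lemma card_induced_arcs_le_mad:
  assumes "pair_graph G" "S \<subseteq> pverts G"
  shows "real (card (parcs G \<inter> S \<times> S)) \<le> mad G * real (card S)"
proof -
  interpret pair_graph G by fact
  let ?H = "\<lparr>pverts = S, parcs = parcs G \<inter> S \<times> S\<rparr>"
  have "finite S"
    using \<open>S \<subseteq> pverts G\<close> pair_finite_verts finite_subset by blast
  have "sym (parcs G)"
    using pair_sym_arcs by (simp add: symmetric_def)
  then have H: "pair_graph ?H"
    using \<open>finite S\<close> pair_no_loops by unfold_locales (auto simp: symmetric_def sym_def)
  then interpret H: pair_graph ?H .
  have "subgraph (with_proj ?H) (with_proj G)"
    using \<open>S \<subseteq> pverts G\<close> wf_digraph H.wf_digraph by (auto simp: subgraph_def compatible_def)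
  with H have "average_degree ?H \<le> mad G"
    unfolding mad_def by (intro Max_ge finite_average_degrees assms(1)) blast
  moreover have "(\<Sum>v\<in>S. out_degree (with_proj ?H) v) = card (parcs G \<inter> S \<times> S)"
  proof -
    have "(\<Sum>v\<in>S. out_degree (with_proj ?H) v)
        = card (\<Union>v\<in>S. out_arcs (with_proj ?H) v)"
      unfolding out_degree_def using \<open>finite S\<close>
      by (subst card_UN_disjoint) (auto simp: out_arcs_def)
    also have "(\<Union>v\<in>S. out_arcs (with_proj ?H) v) = parcs G \<inter> S \<times> S"
      by (auto simp: out_arcs_def)
    finally show ?thesis .
  qed
  ultimately have "real (card (parcs G \<inter> S \<times> S)) / real (card S) \<le> mad G"
    by (simp add: average_degree_def flip: of_nat_sum)
  then show ?thesis
    using \<open>finite S\<close> by (cases "S = {}") (auto simp: field_simps card_gt_0_iff)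
qed

lemma mad_nonneg:
  assumes "pair_graph G"
  shows "0 \<le> mad G"
proof -
  interpret pair_graph G by fact
  have "subgraph (with_proj G) (with_proj G)"
    using wf_digraph by (simp add: subgraph_def compatible_def)
  with assms have "average_degree G \<le> mad G"
    unfolding mad_def by (intro Max_ge finite_average_degrees) auto
  moreover have "0 \<le> average_degree G"
    by (simp add: average_degree_def sum_nonneg)
  ultimately show ?thesis
    by simp
qed

text \<open>\<open>connected\<close> refers to the symmetric closure of \<open>C\<close>. Since
  adjacency and equality of colours are symmetric, that closure contains only monochromatic arcs of
  \<open>G\<close>.\<close>

lemma monochromatic_component_connected:
  assumes "monochromatic_component G f C" "sym (parcs G)"
    and "u \<in> verts C" "v \<in> verts C"
  shows "(u, v) \<in> ({(u, v) \<in> parcs G. f u = f v} \<inter> verts C \<times> verts C)\<^sup>*"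
proof -
  have sub: "subgraph C (with_proj (monochromatic_subgraph G f))" and conn: "connected C"
    using assms(1) by (auto simp: monochromatic_component_def pre_digraph.max_subgraph_def)
  have "(u, v) \<in> (parcs (mk_symmetric C))\<^sup>*"
    using conn assms(3,4) reachable_rtranclI[of "with_proj (mk_symmetric C)" u v]
    by (auto simp: connected_def strongly_connected_def)
  moreover have "parcs (mk_symmetric C) \<subseteq> {(u, v) \<in> parcs G. f u = f v} \<inter> verts C \<times> verts C"
    using sub \<open>sym (parcs G)\<close>
    by (fastforce simp: subgraph_def compatible_def monochromatic_subgraph_def parcs_mk_symmetric
        dest: symD wf_digraph.tail_in_verts wf_digraph.head_in_verts)
  ultimately show ?thesis
    using rtrancl_mono by blast
qed

section \<open>The clustering bound\<close>

lemma choosable_with_clustering_3: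
  assumes "pair_graph G" "7 / 10 * mad G < real k"
  shows "choosable_with_clustering TYPE('c) k 3 G"
  unfolding choosable_with_clustering_def
proof (intro allI impI)
  fix L :: "'a \<Rightarrow> 'c set"
  assume L: "list_assignment k G L"
  interpret pair_graph G by fact
  let ?V = "pverts G" and ?E = "parcs G"
  have E: "?E \<subseteq> ?V \<times> ?V" "sym ?E" "irrefl ?E"
    using wellformed' pair_sym_arcs pair_no_loops by (fastforce simp: symmetric_def irrefl_def)+
  have "0 < k"
    using assms(2) mad_nonneg[OF assms(1)] by (cases k) auto
  \<comment> \<open>The hypothesis reads \<open>mad G < 10 / 7 * real k\<close>, where
    \<open>mad G\<close> bounds arcs, not edges, per vertex: hence twice
    \<open>5 / 7\<close>.\<close>
  obtain x :: "'a \<Rightarrow> real" where x: "\<And>v. 0 < x v"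
    and balanced: "\<And>v. v \<in> ?V \<Longrightarrow> 2 * (\<Sum>u\<in>?E `` {v}. x v / (x u + x v)) < 10 / 7 * real k"
    by (rule exists_balanced_weights[OF pair_finite_verts E card_induced_arcs_le_mad
          mad_nonneg, of "10 / 7 * real k"]) (use assms in auto)
  obtain f where f: "\<And>v. v \<in> ?V \<Longrightarrow> f v \<in> L v"
    and f_mono: "\<And>v. v \<in> ?V \<Longrightarrow>
      real k * (\<Sum>u\<in>{u \<in> ?E `` {v}. f u = f v}. 1 / (x u + x v)) \<le> (\<Sum>u\<in>?E `` {v}. 1 / (x u + x v))"
    by (rule exists_weighted_defective_colouring[OF pair_finite_verts E,
          of "\<lambda>u v. 1 / (x u + x v)" L k])
      (use L x \<open>0 < k\<close> in \<open>auto simp: add.commute list_assignment_def add_nonneg_nonneg less_imp_le\<close>)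
  have mono: "2 * (\<Sum>u\<in>{u \<in> ?E `` {v}. f u = f v}. x v / (x u + x v)) < 10 / 7" if "v \<in> ?V" for v
  proof -
    \<comment> \<open>Multiplying by \<open>x v\<close> turns the weight of each edge at
      \<open>v\<close> into the share of \<open>v\<close> in it.\<close>
    have "real k * (\<Sum>u\<in>{u \<in> ?E `` {v}. f u = f v}. x v / (x u + x v))
        = x v * (real k * (\<Sum>u\<in>{u \<in> ?E `` {v}. f u = f v}. 1 / (x u + x v)))"
      by (simp add: sum_distrib_left mult.commute)
    also have "\<dots> \<le> x v * (\<Sum>u\<in>?E `` {v}. 1 / (x u + x v))"
      using f_mono[OF that] x[of v] by (intro mult_left_mono) auto
    also have "\<dots> = (\<Sum>u\<in>?E `` {v}. x v / (x u + x v))"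
      by (simp add: sum_distrib_left)
    finally have "real k * (2 * (\<Sum>u\<in>{u \<in> ?E `` {v}. f u = f v}. x v / (x u + x v)))
        < real k * (10 / 7)"
      using balanced[OF that] by simp
    then show ?thesis
      using \<open>0 < k\<close> by (simp only: mult_less_cancel_left_pos of_nat_0_less_iff)
  qed
  have "card (verts C) \<le> 3" if C: "monochromatic_component G f C" for C
  proof -
    let ?M = "{(u, v) \<in> ?E. f u = f v}" and ?C = "verts C"
    let ?r = "?M \<inter> ?C \<times> ?C"
    have sub: "?C \<subseteq> ?V" and "?C \<noteq> {}"
      using C by (auto simp: monochromatic_component_def pre_digraph.max_subgraph_def
          subgraph_def monochromatic_subgraph_def connected_def strongly_connected_def)
    have "finite ?C"
      using sub pair_finite_verts finite_subset by blast
    have sym: "sym ?M" "sym ?r"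
      using E(2) by (auto simp: sym_def)
    have "2 * card ?C \<le> card ?r + 2"
      using \<open>finite ?C\<close> \<open>?C \<noteq> {}\<close> sym(1) E(3) monochromatic_component_connected[OF C E(2)]
      by (intro connected_card_le) (auto simp: irrefl_def)
    moreover have "real (card ?r) < 10 / 7 * real (card ?C)"
    proof -
      have "real (card ?r) = 2 * (\<Sum>(v, u)\<in>?r. x v / (x u + x v))"
        using sym(2) \<open>finite ?C\<close> x by (intro sum_balanced_ratio[symmetric]) auto
      also have "(\<Sum>(v, u)\<in>?r. x v / (x u + x v))
          = (\<Sum>v\<in>?C. \<Sum>u\<in>{u \<in> ?C. (v, u) \<in> ?M}. x v / (x u + x v))"
        using \<open>finite ?C\<close> by (subst sum.Sigma) (auto intro!: sum.cong)
      \<comment> \<open>Passes to all neighbours of \<open>v\<close> with its colour, the sets for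
        which \<open>mono\<close> is stated; the terms are nonnegative.\<close>
      also have "2 * \<dots> \<le> 2 * (\<Sum>v\<in>?C. \<Sum>u\<in>{u \<in> ?E `` {v}. f u = f v}. x v / (x u + x v))"
      proof (intro mult_left_mono sum_mono sum_mono2)
        fix v
        show "finite {u \<in> ?E `` {v}. f u = f v}"
          by (rule finite_subset[OF _ finite_Image[OF pair_finite_arcs]]) blast
        show "0 \<le> x v / (x u + x v)" for u
          using x[of u] x[of v] by simp
      qed auto
      also have "\<dots> = (\<Sum>v\<in>?C. 2 * (\<Sum>u\<in>{u \<in> ?E `` {v}. f u = f v}. x v / (x u + x v)))"
        by (rule sum_distrib_left)
      also have "\<dots> < (\<Sum>v\<in>?C. 10 / 7)"
        using \<open>finite ?C\<close> \<open>?C \<noteq> {}\<close> sub mono by (intro sum_strict_mono) auto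
      finally show ?thesis
        by simp
    qed
    \<comment> \<open>\<open>2 * card ?C - 2 < 10 / 7 * card ?C\<close> means
      \<open>card ?C < 7 / 2\<close>.\<close>
    ultimately show ?thesis
      by linarith
  qed
  with f show "\<exists>f. list_colouring G L f \<and> has_clustering G f 3"
    by (auto simp: list_colouring_def has_clustering_def)
qed

theorem theorem5:
  fixes G :: "'a pair_pre_digraph"
  assumes "pair_graph G"
  shows "choosable_with_clustering TYPE('c) (nat \<lfloor>7 / 10 * mad G + 1\<rfloor>) 9 G"
proof -
  \<comment> \<open>Adding 1 before rounding down makes the inequality strict, also when
    \<open>7 / 10 * mad G\<close> is an integer.\<close>
  have "7 / 10 * mad G < real (nat \<lfloor>7 / 10 * mad G + 1\<rfloor>)"
    by linarith
  then have "choosable_with_clustering TYPE('c) (nat \<lfloor>7 / 10 * mad G + 1\<rfloor>) 3 G"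
    using assms by (rule choosable_with_clustering_3[rotated])
  \<comment> \<open>A bound of 3 on the components is in particular a bound of 9.\<close>
  then show ?thesis
    unfolding choosable_with_clustering_def has_clustering_def
    by (meson le_trans numeral_le_iff semiring_norm)
qed

end
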